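(* Let $G$ be a connected graph on $n$ vertices in which every vertex has degree at least $3$. Then $b(G) \leq \lceil \sqrt{n} \rceil + 2$.
   Context: Burning process on a graph $G$: at step $1$ one vertex is set on fire; at every step $i \geq 2$, all neighbours of vertices on fire catch fire, and additionally one new vertex is set on fire. $G$ is $k$-burnable if some choice of vertices makes the whole graph on fire at the end of step $k$. The burning number $b(G)$ is the least $k$ such that $G$ is $k$-burnable. Equivalently, $b(G)$ is the least $k$ such that there are vertices $v_1,\dots,v_k$ with $\bigcup_{i=1}^{k} N_{k-i}[v_i] = V(G)$, where $N_r[v]$ is the set of vertices at distance at most $r$ from $v$. *)

theory Defs
  imports Complex_Main "Graph_Theory.Arc_Walk" "Graph_Theory.Digraph_Component"
begin

text \<open>
  Simple undirected graphs are the locale \<open>graph\<close> of \<open>Graph_Theory\<close>: finite symmetric digraphs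
  without loops and parallel arcs, every edge being represented by its two orientations. Hence the
  degree of a vertex is its \<^const>\<open>out_degree\<close>.
\<close>

text \<open>
  \<open>on_fire G v i\<close> is the set of burning vertices at the end of step \<open>i\<close>, when \<open>v j\<close> is the vertex
  set on fire at step \<open>j\<close>, for \<open>j = 1, 2, \<dots>\<close> (the value \<open>v 0\<close> is not used). As in the covering
  description \<open>k_burnable_iff\<close> below, \<open>v j\<close> may already be burning; such a choice has no effect,
  and it is forced if the whole graph is on fire before the last step.
\<close>

primrec on_fire :: "('a, 'b) pre_digraph \<Rightarrow> (nat \<Rightarrow> 'a) \<Rightarrow> nat \<Rightarrow> 'a set" where
  "on_fire G v 0 = {}"
| "on_fire G v (Suc i) =
     on_fire G v i \<union> {w. \<exists>u \<in> on_fire G v i. u \<rightarrow>\<^bsub>G\<^esub> w} \<union> {v (Suc i)}"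

definition k_burnable :: "('a, 'b) pre_digraph \<Rightarrow> nat \<Rightarrow> bool" where
  "k_burnable G k \<longleftrightarrow>
     (\<exists>v. (\<forall>i \<in> {1..k}. v i \<in> verts G) \<and> on_fire G v k = verts G)"

definition burning_number :: "('a, 'b) pre_digraph \<Rightarrow> nat" where
  "burning_number G = (LEAST k. k_burnable G k)"

text \<open>
  The description by coverings: \<open>closed_nbhd r u\<close> is \<open>N\<^sub>r[u]\<close>, the set of vertices at distance at
  most \<open>r\<close> from \<open>u\<close>.
\<close>

definition (in pre_digraph) closed_nbhd :: "nat \<Rightarrow> 'a \<Rightarrow> 'a set" where
  "closed_nbhd r u = {w \<in> verts G. \<exists>p. awalk u p w \<and> length p \<le> r}"

context wf_digraph
begin

lemma closed_nbhd_0: "u \<in> verts G \<Longrightarrow> closed_nbhd 0 u = {u}"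
  by (auto simp: closed_nbhd_def awalk_Nil_iff)

lemma closed_nbhd_Suc:
  "closed_nbhd (Suc r) u = closed_nbhd r u \<union> {w. \<exists>x \<in> closed_nbhd r u. x \<rightarrow>\<^bsub>G\<^esub> w}"
proof (intro set_eqI iffI)
  fix w assume "w \<in> closed_nbhd (Suc r) u"
  then obtain p where p: "awalk u p w" "length p \<le> Suc r" and w: "w \<in> verts G"
    by (auto simp: closed_nbhd_def)
  show "w \<in> closed_nbhd r u \<union> {w. \<exists>x \<in> closed_nbhd r u. x \<rightarrow>\<^bsub>G\<^esub> w}"
  proof (cases p rule: rev_cases)
    case Nil
    then show ?thesis using p w by (force simp: closed_nbhd_def)
  next
    case (snoc q e)
    then have q: "awalk u q (tail G e)" "e \<in> arcs G" "head G e = w"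
      using p by (auto simp: awalk_Cons_iff awalk_Nil_iff)
    then have "tail G e \<in> closed_nbhd r u"
      using p snoc by (auto simp: closed_nbhd_def)
    moreover have "tail G e \<rightarrow>\<^bsub>G\<^esub> w"
      using q by (auto simp: arcs_ends_conv)
    ultimately show ?thesis by blast
  qed
next
  fix w assume "w \<in> closed_nbhd r u \<union> {w. \<exists>x \<in> closed_nbhd r u. x \<rightarrow>\<^bsub>G\<^esub> w}"
  then show "w \<in> closed_nbhd (Suc r) u"
  proof
    assume "w \<in> closed_nbhd r u"
    then show ?thesis by (auto simp: closed_nbhd_def intro: le_SucI)
  next
    assume "w \<in> {w. \<exists>x \<in> closed_nbhd r u. x \<rightarrow>\<^bsub>G\<^esub> w}"
    then obtain x p e where p: "awalk u p x" "length p \<le> r"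
      and e: "e \<in> arcs G" "tail G e = x" "head G e = w"
      by (auto simp: closed_nbhd_def arcs_ends_conv)
    then have "awalk u (p @ [e]) w"
      by (auto simp: awalk_Cons_iff awalk_Nil_iff)
    then show ?thesis using p e
      by (auto simp: closed_nbhd_def intro!: exI[of _ "p @ [e]"])
  qed
qed

lemma on_fire_eq_closed_nbhds:
  assumes "\<forall>i \<in> {1..k}. v i \<in> verts G"
  shows "on_fire G v k = (\<Union>i \<in> {1..k}. closed_nbhd (k - i) (v i))"
  using assms
proof (induction k)
  case (Suc k)
  let ?D = "\<lambda>S. {w. \<exists>x \<in> S. x \<rightarrow>\<^bsub>G\<^esub> w}"
  have "on_fire G v (Suc k) = on_fire G v k \<union> ?D (on_fire G v k) \<union> {v (Suc k)}"
    by simp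
  also have "on_fire G v k = (\<Union>i \<in> {1..k}. closed_nbhd (k - i) (v i))"
    using Suc by simp
  also have "(\<Union>i \<in> {1..k}. closed_nbhd (k - i) (v i)) \<union> ?D (\<Union>i \<in> {1..k}. closed_nbhd (k - i) (v i)) =
      (\<Union>i \<in> {1..k}. closed_nbhd (k - i) (v i) \<union> ?D (closed_nbhd (k - i) (v i)))"
    by blast
  also have "\<dots> = (\<Union>i \<in> {1..k}. closed_nbhd (Suc k - i) (v i))"
    by (rule SUP_cong) (simp_all add: Suc_diff_le closed_nbhd_Suc)
  also have "{v (Suc k)} = closed_nbhd (Suc k - Suc k) (v (Suc k))"
    using Suc.prems by (simp add: closed_nbhd_0)
  also have "(\<Union>i \<in> {1..k}. closed_nbhd (Suc k - i) (v i)) \<union> \<dots> =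
      (\<Union>i \<in> {1..Suc k}. closed_nbhd (Suc k - i) (v i))"
    by (simp add: atLeastAtMostSuc_conv Un_commute)
  finally show ?case .
qed simp

lemma k_burnable_iff:
  "k_burnable G k \<longleftrightarrow> (\<exists>v. (\<forall>i \<in> {1..k}. v i \<in> verts G) \<and>
     (\<Union>i \<in> {1..k}. closed_nbhd (k - i) (v i)) = verts G)"
  unfolding k_burnable_def
  by (intro ex_cong1 conj_cong refl) (simp only: on_fire_eq_closed_nbhds)

end

end

theory Submission
  imports Defs
begin

text \<open>
  A connected graph of minimum degree at least \<open>3\<close> has a connected dominating set \<open>I\<close> with at most
  three quarters of the vertices (Kleitman and West). With \<open>K = \<lceil>\<surd>n\<rceil>\<close> we have
  \<open>4 \<bar>I\<bar> \<le> 3 K\<^sup>2\<close>, and it suffices to cover \<open>I\<close> by balls of radii \<open>0, \<dots>, K\<close>: enlarging every radius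
  by one covers the whole graph within \<open>K + 2\<close> steps.

  The balls are used up in pairs of a small radius \<open>b\<close>, taken from the lower half of \<open>{0..K}\<close>, and a
  large radius from the set \<open>W\<close> of those remaining in the upper half, with maximum \<open>M\<close>. First choose a
  largest connected set \<open>Y\<close> of at most \<open>2 b + 1\<close> vertices whose removal leaves a connected set, say
  \<open>\<bar>Y\<bar> = 2 b + 1 - \<delta>\<close>, and root a spanning tree of the rest at a neighbour of \<open>Y\<close>. The subtree \<open>X\<close> of
  height \<open>M\<close> below the ancestor of a deepest vertex has, by the maximality of \<open>Y\<close>, at least \<open>\<delta>\<close> vertices
  outside a longest path, so that \<open>X \<union> Y\<close> has at least \<open>2 b + 1 + max (M + 1) (2 t)\<close> vertices, where
  \<open>t \<le> M\<close> is a radius for which one ball covers \<open>X\<close>. Cover \<open>X\<close> by the smallest ball of \<open>W\<close> with radius at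
  least \<open>t\<close>; the bound on \<open>\<bar>X \<union> Y\<bar>\<close> is what keeps the inequalities in \<open>conn_covering\<close> invariant.
\<close>

subsection \<open>Balls and connected sets of a symmetric relation\<close>

text \<open>Balls are taken in the whole relation \<open>E\<close>, so a ball found inside one set
  keeps its vertices when that set shrinks.\<close>

definition near :: "('a \<times> 'a) set \<Rightarrow> nat \<Rightarrow> 'a \<Rightarrow> 'a set" where
  "near E k c = {x. \<exists>n\<le>k. (c, x) \<in> E ^^ n}"

definition conn :: "('a \<times> 'a) set \<Rightarrow> 'a set \<Rightarrow> bool" where
  "conn E S \<longleftrightarrow> (\<forall>x\<in>S. \<forall>y\<in>S. (x, y) \<in> (Restr E S)\<^sup>*)"

lemma near_mono: "k \<le> k' \<Longrightarrow> near E k c \<subseteq> near E k' c"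
  unfolding near_def using le_trans by blast

lemma sym_relpow:
  assumes "sym E" shows "(x, y) \<in> E ^^ n \<Longrightarrow> (y, x) \<in> E ^^ n"
proof (induction n arbitrary: x y)
  case (Suc n)
  then obtain z where "(x, z) \<in> E ^^ n" "(z, y) \<in> E" by (meson relpow_Suc_E)
  then show ?case using Suc.IH assms by (meson relpow_Suc_I2 symD)
qed simp

lemma sym_rtrancl_Restr:
  assumes "sym E" shows "(x, y) \<in> (Restr E S)\<^sup>* \<Longrightarrow> (y, x) \<in> (Restr E S)\<^sup>*"
proof -
  have "sym (Restr E S)" using assms by (auto simp: sym_def)
  then show "(x, y) \<in> (Restr E S)\<^sup>* \<Longrightarrow> (y, x) \<in> (Restr E S)\<^sup>*"
    using sym_rtrancl symD by metis
qed

lemma connI_root: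
  assumes "sym E" "\<And>x. x \<in> S \<Longrightarrow> (r, x) \<in> (Restr E S)\<^sup>*"
  shows "conn E S"
  unfolding conn_def
proof (intro ballI)
  fix x y assume "x \<in> S" "y \<in> S"
  then show "(x, y) \<in> (Restr E S)\<^sup>*"
    using rtrancl_trans[OF sym_rtrancl_Restr[OF assms(1) assms(2)] assms(2)] by simp
qed

lemma conn_Un:
  assumes "sym E" "conn E A" "conn E B" "a \<in> A" "b \<in> B" "(a, b) \<in> E"
  shows "conn E (A \<union> B)"
proof (rule connI_root[OF assms(1)])
  fix x assume x: "x \<in> A \<union> B"
  have A: "(Restr E A)\<^sup>* \<subseteq> (Restr E (A \<union> B))\<^sup>*" and B: "(Restr E B)\<^sup>* \<subseteq> (Restr E (A \<union> B))\<^sup>*"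
    by (auto intro!: rtrancl_mono)
  show "(a, x) \<in> (Restr E (A \<union> B))\<^sup>*"
  proof (cases "x \<in> A")
    case True
    then show ?thesis using assms(2,4) A unfolding conn_def by blast
  next
    case False
    then have "(b, x) \<in> (Restr E (A \<union> B))\<^sup>*" using x assms(3,5) B unfolding conn_def by blast
    moreover have "(a, b) \<in> Restr E (A \<union> B)" using assms by blast
    ultimately show ?thesis by (rule converse_rtrancl_into_rtrancl[rotated])
  qed
qed

lemma conn_edge:
  assumes "conn E S" "A \<subseteq> S" "A \<noteq> {}" "S - A \<noteq> {}"
  obtains a v where "a \<in> A" "v \<in> S - A" "(a, v) \<in> E"
proof -
  obtain a0 x where a0: "a0 \<in> A" and x: "x \<in> S - A" using assms by blast
  then have "(a0, x) \<in> (Restr E S)\<^sup>*" using assms unfolding conn_def by blast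
  then have "x \<in> S - A \<Longrightarrow> \<exists>a\<in>A. \<exists>v\<in>S - A. (a, v) \<in> E"
    by (induction rule: rtrancl_induct) (use a0 in blast)+
  then show thesis using x that by blast
qed

subsection \<open>Rooted spanning trees\<close>

text \<open>Nothing is assumed about \<open>\<pi> r\<close>, hence the bounds
  \<open>i \<le> dep x\<close> on iterates of \<open>\<pi>\<close> throughout.\<close>

locale search_tree =
  fixes E :: "('a \<times> 'a) set" and S :: "'a set" and r :: 'a
    and \<pi> :: "'a \<Rightarrow> 'a" and dep :: "'a \<Rightarrow> nat"
  assumes sym: "sym E" and fin: "finite S" and root: "r \<in> S" "dep r = 0"
    and parent: "\<And>x. x \<in> S \<Longrightarrow> x \<noteq> r \<Longrightarrow> \<pi> x \<in> S \<and> (\<pi> x, x) \<in> E \<and> dep x = Suc (dep (\<pi> x))"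

text \<open>Breadth-first search: \<open>dep\<close> is the distance from \<open>r\<close> inside
  \<open>S\<close>, and the parent is the last but one vertex of a shortest walk.\<close>

lemma search_tree_exists:
  assumes "sym E" "finite S" "conn E S" "r \<in> S"
  shows "\<exists>\<pi> dep. search_tree E S r \<pi> dep"
proof -
  define dep where "dep x = (LEAST n. (r, x) \<in> (Restr E S) ^^ n)" for x
  have dep_le: "dep x \<le> n" if "(r, x) \<in> (Restr E S) ^^ n" for x n
    unfolding dep_def using that by (rule Least_le)
  have dep: "(r, x) \<in> (Restr E S) ^^ dep x" if "x \<in> S" for x
  proof -
    have "(r, x) \<in> (Restr E S)\<^sup>*" using assms that unfolding conn_def by blast
    then have "\<exists>n. (r, x) \<in> (Restr E S) ^^ n" by (rule rtrancl_imp_relpow)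
    then show ?thesis unfolding dep_def by (rule LeastI_ex)
  qed
  have "\<exists>z. z \<in> S \<and> (z, x) \<in> E \<and> dep x = Suc (dep z)" if x: "x \<in> S" "x \<noteq> r" for x
  proof (cases "dep x")
    case 0
    then show ?thesis using dep[OF x(1)] x(2) by simp
  next
    case (Suc k)
    then obtain z where z: "(r, z) \<in> (Restr E S) ^^ k" "(z, x) \<in> Restr E S"
      using dep[OF x(1)] by (metis relpow_Suc_E)
    have "dep x \<le> Suc (dep z)"
      using z dep[of z] by (intro dep_le) auto
    then have "dep z = k" using dep_le[OF z(1)] Suc by simp
    then show ?thesis using z Suc by blast
  qed
  then obtain \<pi> where "\<And>x. x \<in> S \<Longrightarrow> x \<noteq> r \<Longrightarrow> \<pi> x \<in> S \<and> (\<pi> x, x) \<in> E \<and> dep x = Suc (dep (\<pi> x))"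
    by metis
  moreover have "dep r = 0" using dep_le[of r 0] by simp
  ultimately have "search_tree E S r \<pi> dep"
    using assms by unfold_locales auto
  then show ?thesis by blast
qed

context search_tree
begin

lemma up:
  assumes "x \<in> S" "i \<le> dep x"
  shows "(\<pi> ^^ i) x \<in> S" "dep ((\<pi> ^^ i) x) = dep x - i" "((\<pi> ^^ i) x, x) \<in> E ^^ i"
proof -
  have "(\<pi> ^^ i) x \<in> S \<and> dep ((\<pi> ^^ i) x) = dep x - i \<and> ((\<pi> ^^ i) x, x) \<in> E ^^ i"
    using assms(2)
  proof (induction i)
    case (Suc i)
    let ?z = "(\<pi> ^^ i) x"
    have z: "?z \<in> S" "dep ?z = dep x - i" "(?z, x) \<in> E ^^ i" using Suc by auto
    then have "?z \<noteq> r" using root Suc.prems by auto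
    then have p: "\<pi> ?z \<in> S" "(\<pi> ?z, ?z) \<in> E" "dep ?z = Suc (dep (\<pi> ?z))"
      using parent z by auto
    then show ?case using z(2) relpow_Suc_I2[OF p(2) z(3)] by simp
  qed (use assms in auto)
  then show "(\<pi> ^^ i) x \<in> S" "dep ((\<pi> ^^ i) x) = dep x - i" "((\<pi> ^^ i) x, x) \<in> E ^^ i"
    by auto
qed

definition subtree :: "'a \<Rightarrow> 'a set" where
  "subtree u = {x \<in> S. \<exists>i\<le>dep x. (\<pi> ^^ i) x = u}"

lemma subtree_subset: "subtree u \<subseteq> S"
  by (auto simp: subtree_def)

lemma finite_subtree: "finite (subtree u)"
  using fin subtree_subset finite_subset by blast

lemma subtree_refl: "u \<in> S \<Longrightarrow> u \<in> subtree u"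
  by (auto simp: subtree_def intro: exI[of _ 0])

lemma subtree_up:
  assumes "x \<in> S" "i \<le> dep x" "(\<pi> ^^ i) x \<in> subtree u"
  shows "x \<in> subtree u"
proof -
  obtain j where "j \<le> dep x - i" "(\<pi> ^^ j) ((\<pi> ^^ i) x) = u"
    using assms up by (auto simp: subtree_def)
  then have "(\<pi> ^^ (j + i)) x = u" "j + i \<le> dep x" using assms(2) by (auto simp: funpow_add)
  then show ?thesis using assms(1) by (auto simp: subtree_def)
qed

lemma subtreeD:
  assumes "x \<in> subtree u"
  shows "dep u \<le> dep x" "(\<pi> ^^ (dep x - dep u)) x = u"
    "\<And>j. j \<le> dep x - dep u \<Longrightarrow> (\<pi> ^^ j) x \<in> subtree u"
proof -
  obtain i where i: "x \<in> S" "i \<le> dep x" "(\<pi> ^^ i) x = u"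
    using assms by (auto simp: subtree_def)
  then have d: "dep u = dep x - i" using up by auto
  then have [simp]: "dep x - dep u = i" using i by simp
  show "dep u \<le> dep x" "(\<pi> ^^ (dep x - dep u)) x = u" using i d by auto
  fix j assume "j \<le> dep x - dep u"
  then have j: "j \<le> i" by simp
  then have "(\<pi> ^^ (i - j)) ((\<pi> ^^ j) x) = u"
    using i(3) funpow_add[of "i - j" j \<pi>] by simp
  then show "(\<pi> ^^ j) x \<in> subtree u"
    using up[of x j] i j by (auto simp: subtree_def intro!: exI[of _ "i - j"])
qed

lemma subtree_root: "subtree r = S"
proof -
  have "x \<in> subtree r" if "x \<in> S" for x
  proof -
    have "(\<pi> ^^ dep x) x = r"
      using up[OF that, of "dep x"] parent by force
    then show ?thesis using that by (auto simp: subtree_def)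
  qed
  then show ?thesis using subtree_subset by blast
qed

lemma conn_subtree: "conn E (subtree u)"
proof (rule connI_root[OF sym])
  fix x assume "x \<in> subtree u"
  then obtain i where "i \<le> dep x" "(\<pi> ^^ i) x = u" "x \<in> S" by (auto simp: subtree_def)
  then show "(u, x) \<in> (Restr E (subtree u))\<^sup>*"
  proof (induction i arbitrary: x)
    case (Suc i)
    then have "x \<noteq> r" using root by auto
    then have p: "\<pi> x \<in> S" "(\<pi> x, x) \<in> E" "dep x = Suc (dep (\<pi> x))" using parent Suc by auto
    have i: "(\<pi> ^^ i) (\<pi> x) = u" using Suc.prems by (simp add: funpow_swap1)
    then have "(u, \<pi> x) \<in> (Restr E (subtree u))\<^sup>*" using Suc p by auto
    moreover have "x \<in> subtree u" "\<pi> x \<in> subtree u" using Suc.prems p i by (auto simp: subtree_def)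
    ultimately show ?case using p by (auto intro: rtrancl.rtrancl_into_rtrancl[of _ "\<pi> x"])
  qed simp
qed

text \<open>Walking up from a vertex outside \<open>subtree u\<close> never enters it, since an
  ancestor in \<open>subtree u\<close> would put the vertex there too.\<close>

lemma conn_minus_subtree:
  assumes "u \<noteq> r" "u \<in> S" shows "conn E (S - subtree u)" "r \<in> S - subtree u"
proof -
  show r: "r \<in> S - subtree u" using root assms by (auto simp: subtree_def)
  show "conn E (S - subtree u)"
  proof (rule connI_root[OF sym])
    fix x assume "x \<in> S - subtree u"
    then show "(r, x) \<in> (Restr E (S - subtree u))\<^sup>*"
    proof (induction "dep x" arbitrary: x rule: less_induct)
      case less
      show ?case
      proof (cases "x = r")
        case False
        then have p: "\<pi> x \<in> S" "(\<pi> x, x) \<in> E" "dep x = Suc (dep (\<pi> x))" using parent less by auto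
        then have "\<pi> x \<notin> subtree u" using subtree_up[of x 1 u] less.prems by auto
        moreover have "(r, \<pi> x) \<in> (Restr E (S - subtree u))\<^sup>*"
          using less.hyps[of "\<pi> x"] p calculation by simp
        ultimately show ?thesis
          using p less.prems by (auto intro: rtrancl.rtrancl_into_rtrancl[of _ "\<pi> x"])
      qed simp
    qed
  qed
qed

end

section \<open>The path from a deepest vertex to the root and the branches leaving it\<close>

locale deep_search_tree = search_tree +
  fixes u0 :: 'a
  assumes u0: "u0 \<in> S" and deepest: "\<And>x. x \<in> S \<Longrightarrow> dep x \<le> dep u0"
begin

definition anc :: "nat \<Rightarrow> 'a" where
  "anc i = (\<pi> ^^ i) u0"

lemma anc:
  assumes "i \<le> dep u0" shows "anc i \<in> S" "dep (anc i) = dep u0 - i"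
  using up[OF u0 assms] by (auto simp: anc_def)

lemma anc_path:
  assumes "i \<le> j" "j \<le> dep u0" shows "(anc j, anc i) \<in> E ^^ (j - i)"
proof -
  have "anc j = (\<pi> ^^ (j - i)) (anc i)"
    using assms funpow_add[of "j - i" i \<pi>] by (simp add: anc_def)
  then show ?thesis using up(3)[of "anc i" "j - i"] anc[of i] assms by simp
qed

lemma anc_in_subtree:
  assumes "i \<le> j" "j \<le> dep u0" shows "anc i \<in> subtree (anc j)"
proof -
  have "anc j = (\<pi> ^^ (j - i)) (anc i)"
    using assms funpow_add[of "j - i" i \<pi>] by (simp add: anc_def)
  then show ?thesis using anc[of i] assms by (auto simp: subtree_def intro!: exI[of _ "j - i"])
qed

lemma inj_anc: "inj_on anc {..dep u0}"
proof (rule inj_onI)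
  fix i j assume "i \<in> {..dep u0}" "j \<in> {..dep u0}" "anc i = anc j"
  then show "i = j" using anc(2)[of i] anc(2)[of j] by auto
qed

lemma subtree_mono:
  assumes "i \<le> j" "j \<le> dep u0" shows "subtree (anc i) \<subseteq> subtree (anc j)"
proof
  fix x assume x: "x \<in> subtree (anc i)"
  then show "x \<in> subtree (anc j)"
    using subtreeD[OF x] subtree_up[of x "dep x - dep (anc i)" "anc j"] anc_in_subtree[OF assms] subtree_subset by auto
qed

lemma subtree_le:
  assumes "x \<in> subtree (anc i)" "i \<le> dep u0" shows "dep x - dep (anc i) \<le> i"
  using deepest[of x] assms anc[of i] subtree_subset by fastforce

text \<open>
  The path from \<open>x\<close> to the root meets the path from the deepest vertex \<open>u0\<close> for the first time at
  \<open>anc (br x)\<close>, after \<open>len x\<close> steps.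
\<close>

definition br :: "'a \<Rightarrow> nat" where
  "br x = (LEAST i. x \<in> subtree (anc i))"

definition len :: "'a \<Rightarrow> nat" where
  "len x = dep x - dep (anc (br x))"

lemma br:
  assumes "x \<in> subtree (anc k)" "k \<le> dep u0"
  shows "br x \<le> k" "x \<in> subtree (anc (br x))" "len x \<le> br x"
proof -
  show 1: "br x \<le> k" unfolding br_def using assms(1) by (rule Least_le)
  show 2: "x \<in> subtree (anc (br x))" unfolding br_def using assms(1) by (rule LeastI)
  show "len x \<le> br x" unfolding len_def using subtree_le[OF 2] 1 assms by simp
qed

lemma not_in_subtree_less_br: "i < br x \<Longrightarrow> x \<notin> subtree (anc i)"
  unfolding br_def using not_less_Least by blast

text \<open>From \<open>anc t\<close>, follow the path of \<open>u0\<close> to the branching point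
  and then go down to \<open>x\<close>. If that point is above \<open>anc t\<close>, the hypothesis
  bounds the length; if below, \<open>len x \<le> br x\<close> does, as \<open>u0\<close> is
  deepest.\<close>

lemma subtree_subset_near:
  assumes k: "k \<le> dep u0" and t: "t \<le> k" and *: "\<And>x. x \<in> subtree (anc k) \<Longrightarrow> br x + len x \<le> 2 * t"
  shows "subtree (anc k) \<subseteq> near E t (anc t)"
proof
  fix x assume x: "x \<in> subtree (anc k)"
  note b = br[OF x k]
  have xS: "x \<in> S" using x subtree_subset by blast
  have "(anc (br x), x) \<in> E ^^ len x"
    using subtreeD[OF b(2)] up(3)[OF xS, of "len x"] by (simp add: len_def)
  moreover have "(anc t, anc (br x)) \<in> E ^^ (if br x \<le> t then t - br x else br x - t)"
    using anc_path[of "br x" t] sym_relpow[OF sym anc_path[of t "br x"]] b k t by auto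
  ultimately have "(anc t, x) \<in> E ^^ ((if br x \<le> t then t - br x else br x - t) + len x)"
    by (auto simp: relpow_add)
  moreover have "(if br x \<le> t then t - br x else br x - t) + len x \<le> t"
    using b *[OF x] by auto
  ultimately show "x \<in> near E t (anc t)" unfolding near_def by blast
qed

lemma branch:
  assumes x: "x \<in> subtree (anc k)" and k: "k \<le> dep u0"
  defines "B \<equiv> (\<lambda>i. (\<pi> ^^ i) x) ` {..<len x}"
  shows "B \<subseteq> subtree (anc k)" "card B = len x" "\<And>i. i < br x \<Longrightarrow> B \<inter> subtree (anc i) = {}"
    "B \<inter> anc ` {..k} = {}"
proof -
  note b = br[OF x k]
  have xS: "x \<in> S" using x subtree_subset by blast
  have len: "len x \<le> dep x" by (simp add: len_def)
  have bk: "br x \<le> dep u0" using b k by simp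
  show "B \<subseteq> subtree (anc k)"
    using subtreeD(3)[OF b(2)] subtree_mono[OF b(1) k] by (auto simp: B_def len_def)
  have "inj_on (\<lambda>i. (\<pi> ^^ i) x) {..<len x}"
  proof (rule inj_onI)
    fix i j assume "i \<in> {..<len x}" "j \<in> {..<len x}" "(\<pi> ^^ i) x = (\<pi> ^^ j) x"
    then show "i = j" using up(2)[OF xS, of i] up(2)[OF xS, of j] len by auto
  qed
  then show "card B = len x" by (simp add: B_def card_image)
  show disj: "B \<inter> subtree (anc i) = {}" if i: "i < br x" for i
  proof -
    have "(\<pi> ^^ j) x \<notin> subtree (anc i)" if "j < len x" for j
      using not_in_subtree_less_br[OF i] subtree_up[OF xS, of j "anc i"] len that by linarith
    then show ?thesis by (auto simp: B_def)
  qed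
  have "anc i \<notin> B" if i: "i \<le> k" for i
  proof
    assume "anc i \<in> B"
    then obtain j where j: "j < len x" "anc i = (\<pi> ^^ j) x" by (auto simp: B_def)
    have "i \<ge> br x" using disj[of i] \<open>anc i \<in> B\<close> anc_in_subtree[of i i] i k by force
    moreover have "dep u0 - i = dep x - j" using j up(2)[OF xS, of j] len anc[of i] i k by simp
    moreover have "dep (anc (br x)) = dep u0 - br x" using anc[OF bk] by simp
    moreover have "dep (anc (br x)) \<le> dep x" using subtreeD[OF b(2)] by simp
    ultimately show False using j(1) i k bk unfolding len_def by linarith
  qed
  then show "B \<inter> anc ` {..k} = {}" by auto
qed

lemma card_subtree_ge:
  assumes x: "x \<in> subtree (anc k)" and k: "k \<le> dep u0"
  shows "k + 1 + len x \<le> card (subtree (anc k))"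
proof -
  let ?B = "(\<lambda>i. (\<pi> ^^ i) x) ` {..<len x}"
  have "card (anc ` {..k} \<union> ?B) = k + 1 + len x"
    using branch[OF assms] inj_on_subset[OF inj_anc, of "{..k}"] k
    by (subst card_Un_disjoint) (auto simp: card_image)
  moreover have "anc ` {..k} \<union> ?B \<subseteq> subtree (anc k)"
    using branch(1)[OF assms] anc_in_subtree k by auto
  ultimately show ?thesis using card_mono[OF finite_subtree] by metis
qed

text \<open>
  The path joining \<open>u0\<close> and \<open>x\<close> has \<open>br x + len x + 1\<close> vertices. The other \<open>c - \<beta>\<close> vertices lie off that
  path in the smallest subtree \<open>subtree (anc i)\<close> with more than \<open>c\<close> vertices, or, if this subtree contains
  the branching point of \<open>x\<close>, on the way from there up to \<open>anc k\<close>.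
\<close>

lemma card_subtree_ge_excess:
  assumes x: "x \<in> subtree (anc k)" and k: "k \<le> dep u0" and "c \<le> k"
    and \<beta>: "\<And>i. i \<le> k \<Longrightarrow> card (subtree (anc i)) \<le> c \<Longrightarrow> card (subtree (anc i)) \<le> \<beta>"
  shows "br x + len x + 1 + c \<le> card (subtree (anc k)) + \<beta>"
proof (cases "\<exists>i<br x. c < card (subtree (anc i))")
  case True
  note b = br[OF x k]
  let ?B = "(\<lambda>i. (\<pi> ^^ i) x) ` {..<len x}"
  define i where "i = (LEAST i. c < card (subtree (anc i)))"
  have i: "c < card (subtree (anc i))" "i < br x"
    using True LeastI[of "\<lambda>i. c < card (subtree (anc i))"] Least_le[of "\<lambda>i. c < card (subtree (anc i))"]
    unfolding i_def by (blast, meson le_less_trans)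
  have ik: "i \<le> k" using i b by simp
  \<comment> \<open>By minimality of \<open>i\<close>, the subtree at \<open>anc (i - 1)\<close> has
    at most \<open>c\<close>, hence at most \<open>\<beta>\<close>, vertices; it contains
    \<open>anc 0\<close>, ..., \<open>anc (i - 1)\<close>.\<close>
  have "i \<le> \<beta>"
  proof (cases i)
    case (Suc i')
    then have "card (subtree (anc i')) \<le> c"
      using not_less_Least[of i' "\<lambda>i. c < card (subtree (anc i))"] by (simp add: i_def)
    then have "card (subtree (anc i')) \<le> \<beta>" using \<beta>[of i'] ik Suc by simp
    moreover have "i' + 1 \<le> card (subtree (anc i'))"
      using card_subtree_ge[of "anc i'" i'] anc_in_subtree[of i' i'] ik k Suc by simp
    ultimately show ?thesis using Suc by simp
  qed simp
  let ?P = "anc ` {i<..k}"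
  have "inj_on anc {i<..k}" using k by (intro inj_on_subset[OF inj_anc]) auto
  then have P: "card ?P = k - i" by (simp add: card_image)
  have "?P \<inter> subtree (anc i) = {}"
    using subtreeD(1) anc(2) k ik by fastforce
  then have "card (subtree (anc i) \<union> ?P \<union> ?B) = card (subtree (anc i)) + (k - i) + len x"
    using branch(2,4)[OF x k] branch(3)[OF x k i(2)] P finite_subtree
    by (subst card_Un_disjoint, simp, simp, fastforce, subst card_Un_disjoint) auto
  moreover have "subtree (anc i) \<union> ?P \<union> ?B \<subseteq> subtree (anc k)"
    using branch(1)[OF x k] anc_in_subtree k subtree_mono[OF ik k] by auto
  ultimately have "card (subtree (anc i)) + (k - i) + len x \<le> card (subtree (anc k))"
    using card_mono[OF finite_subtree] by metis
  then show ?thesis using i \<open>i \<le> \<beta>\<close> b ik by linarith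
next
  case False
  note b = br[OF x k]
  have "br x \<le> \<beta>"
  proof (cases "br x")
    case (Suc i')
    then have "card (subtree (anc i')) \<le> \<beta>" using \<beta>[of i'] False b not_less[of c] by fastforce
    moreover have "i' + 1 \<le> card (subtree (anc i'))"
      using card_subtree_ge[of "anc i'" i'] anc_in_subtree[of i' i'] k b Suc by simp
    ultimately show ?thesis using Suc by simp
  qed simp
  then show ?thesis using card_subtree_ge[OF x k] b \<open>c \<le> k\<close> by linarith
qed

end

lemma (in search_tree) deep_search_tree_exists: "\<exists>u0. deep_search_tree E S r \<pi> dep u0"
proof -
  have "Max (dep ` S) \<in> dep ` S" using fin root by (intro Max_in) auto
  then obtain u0 where "u0 \<in> S" "dep u0 = Max (dep ` S)" by auto
  then have "deep_search_tree E S r \<pi> dep u0" using fin by unfold_locales auto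
  then show ?thesis by blast
qed

subsection \<open>Covering a connected set by balls of distinct radii\<close>

text \<open>A tree path through a deepest vertex has at most \<open>2 * k + 1\<close> vertices. The
  centre lies \<open>k\<close> steps above that vertex, or at the root if the tree is
  shallower.\<close>

lemma conn_center:
  assumes E: "sym E" and S: "finite S" "conn E S" "S \<noteq> {}" and card: "card S \<le> 2 * k + 1"
  shows "\<exists>c\<in>S. S \<subseteq> near E k c"
proof -
  obtain r where "r \<in> S" using S by blast
  then obtain \<pi> dep where "search_tree E S r \<pi> dep" using search_tree_exists E S by metis
  then interpret search_tree E S r \<pi> dep .
  obtain u0 where "deep_search_tree E S r \<pi> dep u0" using deep_search_tree_exists by blast
  then interpret deep_search_tree E S r \<pi> dep u0 .
  have "(\<pi> ^^ dep u0) u0 = r" using up[OF u0, of "dep u0"] parent by force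
  then have subtree: "subtree (anc (dep u0)) = S" by (simp add: anc_def subtree_root)
  define t where "t = min k (dep u0)"
  have "subtree (anc (dep u0)) \<subseteq> near E t (anc t)"
  proof (rule subtree_subset_near)
    fix x assume x: "x \<in> subtree (anc (dep u0))"
    have "dep u0 + 1 + len x \<le> card S" using card_subtree_ge[OF x] subtree by simp
    then show "br x + len x \<le> 2 * t" using br[OF x] card by (auto simp: t_def min_def)
  qed (auto simp: t_def)
  then have "S \<subseteq> near E k (anc t)" using subtree near_mono[of t k] by (fastforce simp: t_def)
  then show ?thesis using anc(1)[of t] by (auto simp: t_def)
qed

text \<open>One round of the covering. The radius \<open>t\<close> is kept apart from
  \<open>M\<close> so that a smaller ball than the largest one can be spent.\<close>

lemma remove_two:
  assumes E: "sym E" and S: "finite S" "conn E S" "S \<noteq> {}" and M: "2 * b + 1 \<le> M"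
  shows "(\<exists>c\<in>S. \<exists>d\<in>S. S \<subseteq> near E M c \<union> near E b d) \<or>
    (\<exists>c\<in>S. \<exists>d\<in>S. \<exists>t\<le>M. \<exists>S'\<subseteq>S. conn E S' \<and> S' \<noteq> {} \<and> S \<subseteq> near E t c \<union> near E b d \<union> S' \<and>
      card S' + (2 * b + 1) + (M + 1) \<le> card S \<and> card S' + (2 * b + 1) + 2 * t \<le> card S)"
    (is "?covered \<or> ?removed")
proof (cases "card S \<le> 2 * M + 1")
  case True
  then show ?thesis using conn_center[OF E S True] by blast
next
  case False
  define good where "good X \<longleftrightarrow> X \<subseteq> S \<and> X \<noteq> {} \<and> S - X \<noteq> {} \<and> conn E X \<and> conn E (S - X) \<and> card X \<le> 2 * b + 1"
    for X
  \<comment> \<open>A deepest vertex of a spanning tree is a leaf, and a leaf can be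
    removed.\<close>
  have "\<exists>X. good X"
  proof -
    obtain r where r: "r \<in> S" using S by blast
    then obtain \<pi> dep where "search_tree E S r \<pi> dep" using search_tree_exists E S by metis
    then interpret search_tree E S r \<pi> dep .
    obtain u0 where "deep_search_tree E S r \<pi> dep u0" using deep_search_tree_exists by blast
    then interpret deep_search_tree E S r \<pi> dep u0 .
    have "u0 \<noteq> r"
    proof
      assume "u0 = r"
      then have "\<And>x. x \<in> S \<Longrightarrow> x = r" using deepest root parent by fastforce
      then have "S \<subseteq> {r}" by blast
      then have "card S \<le> 1" using card_mono[of "{r}" S] by simp
      then show False using False by simp
    qed
    have "x = u0" if x: "x \<in> subtree u0" for x
    proof -
      have "dep x = dep u0" using subtreeD(1)[OF x] deepest[of x] subtree_subset x by fastforce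
      then show ?thesis using subtreeD(2)[OF x] by simp
    qed
    then have "subtree u0 = {u0}" using subtree_refl[OF u0] by blast
    then have "good {u0}"
      using conn_subtree[of u0] conn_minus_subtree[OF \<open>u0 \<noteq> r\<close> u0] u0 by (auto simp: good_def)
    then show ?thesis by blast
  qed
  then obtain X where "good X" by blast
  moreover have "\<forall>X. good X \<longrightarrow> card X < 2 * b + 2" by (simp add: good_def)
  ultimately obtain Y where Y: "good Y" and max: "\<And>X. good X \<Longrightarrow> card X \<le> card Y"
    using ex_has_greatest_nat[of good X card "2 * b + 2"] by blast
  note Y' = Y[unfolded good_def]
  obtain d where d: "d \<in> Y" "Y \<subseteq> near E b d"
    using conn_center[OF E _ _ _ , of Y b] Y' S finite_subset by metis
  obtain a r where ar: "a \<in> Y" "r \<in> S - Y" "(a, r) \<in> E"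
    using conn_edge[OF S(2), of Y] Y' by metis
  obtain \<pi> dep where "search_tree E (S - Y) r \<pi> dep"
    using search_tree_exists[OF E, of "S - Y" r] Y' S ar by auto
  then interpret search_tree E "S - Y" r \<pi> dep .
  obtain u0 where "deep_search_tree E (S - Y) r \<pi> dep u0" using deep_search_tree_exists by blast
  then interpret deep_search_tree E "S - Y" r \<pi> dep u0 .
  show ?thesis
  proof (cases "dep u0 \<le> M")
    case True
    have "x \<in> near E M r" if "x \<in> S - Y" for x
    proof -
      have "(\<pi> ^^ dep x) x = r" using up[OF that, of "dep x"] parent by force
      then have "(r, x) \<in> E ^^ dep x" using up(3)[OF that, of "dep x"] by simp
      then show ?thesis using deepest[OF that] True unfolding near_def by (auto intro!: exI[of _ "dep x"])
    qed
    then show ?thesis using d ar Y' by blast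
  next
    case deep: False
    then have Mk: "M \<le> dep u0" by simp
    have not_root: "anc i \<noteq> r" if "i \<le> M" for i
      using anc(2)[of i] that deep root by auto
    let ?X = "subtree (anc M)"
    \<comment> \<open>When a subtree not containing \<open>r\<close> is cut off, \<open>Y\<close>
      stays attached to the rest through the edge from \<open>a\<close> to \<open>r\<close>. So a
      small subtree competes with \<open>Y\<close> in size.\<close>
    have small: "card (subtree (anc i)) \<le> card Y" if i: "i \<le> M" "card (subtree (anc i)) \<le> 2 * b + 1" for i
    proof -
      have iS: "anc i \<in> S - Y" using anc i Mk by simp
      note m = conn_minus_subtree[OF not_root[OF i(1)] iS]
      have "conn E (Y \<union> (S - Y - subtree (anc i)))"
        using conn_Un[OF E _ m(1) ar(1) m(2) ar(3)] Y' by simp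
      moreover have "Y \<union> (S - Y - subtree (anc i)) = S - subtree (anc i)"
        using subtree_subset Y' by blast
      ultimately have "good (subtree (anc i))"
        unfolding good_def using conn_subtree subtree_refl[OF iS] subtree_subset[of "anc i"] i(2) ar m(2) by auto
      then show ?thesis by (rule max)
    qed
    define D where "D = Max ((\<lambda>x. br x + len x) ` ?X)"
    have XM: "anc M \<in> ?X" using anc_in_subtree Mk by simp
    have "D \<in> (\<lambda>x. br x + len x) ` ?X"
      unfolding D_def using finite_subtree XM by (intro Max_in) auto
    then obtain z where z: "z \<in> ?X" "D = br z + len z" by blast
    have D: "br x + len x \<le> D" if "x \<in> ?X" for x
      unfolding D_def using finite_subtree that by (intro Max_ge) auto
    have "D \<le> 2 * M" using z br[OF z(1) Mk] by simp
    have "M \<le> br (anc M)"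
    proof (rule ccontr)
      assume "\<not> M \<le> br (anc M)"
      then show False
        using br[OF XM Mk] subtreeD(1)[of "anc M" "anc (br (anc M))"] anc(2)[of M] anc(2)[of "br (anc M)"] Mk
        by simp
    qed
    then have "M \<le> D" using D[OF XM] by simp
    have excess: "D + 1 + (2 * b + 1) \<le> card ?X + card Y"
      using card_subtree_ge_excess[OF z(1) Mk M small] z(2) by simp
    \<comment> \<open>Half of \<open>D\<close> rounded up; the rounding costs at most the
      \<open>1\<close> in \<open>D + 1\<close>, so both size bounds follow from
      \<open>excess\<close>.\<close>
    define t where "t = (D + 1) div 2"
    have t: "t \<le> M" "D \<le> 2 * t" "2 * t \<le> D + 1" using \<open>D \<le> 2 * M\<close> by (auto simp: t_def)
    have near: "?X \<subseteq> near E t (anc t)"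
      using subtree_subset_near[OF Mk t(1)] D t(2) le_trans by blast
    note m = conn_minus_subtree[OF not_root[OF order_refl] anc(1)[OF Mk]]
    let ?S' = "S - Y - ?X"
    have "card S = card ?S' + card ?X + card Y"
      using S Y' subtree_subset[of "anc M"] card_Diff_subset[of Y S] card_Diff_subset[of ?X "S - Y"]
        card_mono[of "S - Y" ?X] card_mono[of S Y] finite_subset[of Y S] finite_subtree[of "anc M"] by simp
    then have "card ?S' + (2 * b + 1) + (M + 1) \<le> card S" "card ?S' + (2 * b + 1) + 2 * t \<le> card S"
      using excess t \<open>M \<le> D\<close> by linarith+
    moreover have "S \<subseteq> near E t (anc t) \<union> near E b d \<union> ?S'" using near d by blast
    moreover have "?S' \<subseteq> S" "?S' \<noteq> {}" using m by blast+
    moreover have "anc t \<in> S" "d \<in> S" using anc(1)[of t] t(1) Mk d Y' by auto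
    ultimately have ?removed using m(1) t(1) by blast
    then show ?thesis ..
  qed
qed

text \<open>
  The hypothesis on \<open>x \<in> W\<close> is dictated by the following situation: the radii of \<open>W\<close> above \<open>x\<close> remove only
  \<open>2 (x + 1)\<close> vertices each, after which \<open>x\<close> is the maximum and the remaining radii remove only \<open>x + 1\<close>
  vertices each. The summand \<open>m\<^sup>2\<close> is the sum of \<open>2 b + 1\<close> over the small radii \<open>b < m\<close>, and \<open>2 L + 1\<close>
  vertices may be left to the last ball.
\<close>

lemma conn_covering:
  assumes E: "sym E"
  shows "finite S \<Longrightarrow> conn E S \<Longrightarrow> S \<noteq> {} \<Longrightarrow> finite W \<Longrightarrow> card W = m + 1 \<Longrightarrow> (\<And>x. x \<in> W \<Longrightarrow> L \<le> x) \<Longrightarrow>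
    m \<le> L \<Longrightarrow>
    (\<And>x. x \<in> W \<Longrightarrow> card S \<le> 2 * L + 1 + m\<^sup>2 + (m + card {z \<in> W. x < z}) * (x + 1)) \<Longrightarrow>
    \<exists>f. range f \<subseteq> S \<and> S \<subseteq> (\<Union>k \<in> W \<union> {..<m}. near E k (f k))"
proof (induction m arbitrary: S W)
  case 0
  then obtain x where x: "W = {x}" by (metis One_nat_def add_0 card_1_singletonE)
  then have none: "{z \<in> W. x < z} = {}" by auto
  have "card S \<le> 2 * x + 1" using 0(8)[of x, unfolded none] 0(6)[of x] x by simp
  then obtain c where "c \<in> S" "S \<subseteq> near E x c" using conn_center[OF E] 0 by metis
  then show ?case using x by (intro exI[of _ "\<lambda>_. c"]) auto
next
  case (Suc m)
  define M where "M = Max W"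
  have W0: "W \<noteq> {}" using Suc.prems by auto
  then have MW: "M \<in> W" and M: "\<And>x. x \<in> W \<Longrightarrow> x \<le> M" using Suc.prems by (auto simp: M_def)
  have "W \<subseteq> {L..M}" using M Suc.prems by auto
  then have "card W \<le> M + 1 - L" using card_mono[of "{L..M}" W] by simp
  \<comment> \<open>The \<open>m + 2\<close> radii of \<open>W\<close> lie in \<open>{L..M}\<close>
    and \<open>L > m\<close>, so \<open>M\<close> is large enough to be paired with
    \<open>m\<close>.\<close>
  then have "2 * m + 1 \<le> M" using Suc.prems by simp
  from remove_two[OF E Suc.prems(1-3) this] show ?case
  proof (elim disjE bexE exE conjE)
    fix c d assume cd: "c \<in> S" "d \<in> S" "S \<subseteq> near E M c \<union> near E m d"
    have "M \<noteq> m" using \<open>2 * m + 1 \<le> M\<close> by simp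
    let ?f = "(\<lambda>_. c)(m := d)"
    have "near E M c \<union> near E m d \<subseteq> (\<Union>k \<in> W \<union> {..<Suc m}. near E k (?f k))"
      using MW \<open>M \<noteq> m\<close> by force
    then show ?case using cd by (intro exI[of _ ?f]) auto
  next
    fix c d t S'
    assume cd: "c \<in> S" "d \<in> S" and t: "t \<le> M" and S': "S' \<subseteq> S" "conn E S'" "S' \<noteq> {}"
      and cov: "S \<subseteq> near E t c \<union> near E m d \<union> S'"
      and card: "card S' + (2 * m + 1) + (M + 1) \<le> card S" "card S' + (2 * m + 1) + 2 * t \<le> card S"
    \<comment> \<open>For \<open>x < y\<close> the required bound drops by
      \<open>2 * (x + 1) \<le> 2 * t\<close>, since both \<open>m\<close> and the number of larger
      radii decrease; for \<open>x > y\<close> only \<open>m\<close> does, and the drop is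
      \<open>x + 1 \<le> M + 1\<close>. The squares account for \<open>2 * m + 1\<close>.\<close>
    define y where "y = Min {z \<in> W. t \<le> z}"
    have "y \<in> {z \<in> W. t \<le> z}" unfolding y_def using MW t Suc.prems by (intro Min_in) auto
    then have y: "y \<in> W" "t \<le> y" by auto
    have below: "x < t" if "x \<in> W" "x < y" for x
      using that Suc.prems Min_le[of "{z \<in> W. t \<le> z}" x] by (fastforce simp: y_def)
    have "\<exists>f. range f \<subseteq> S' \<and> S' \<subseteq> (\<Union>k \<in> (W - {y}) \<union> {..<m}. near E k (f k))"
    proof (rule Suc.IH)
      fix x assume x: "x \<in> W - {y}"
      let ?q = "card {z \<in> W - {y}. x < z}"
      have old: "card S \<le> 2 * L + 1 + (Suc m)\<^sup>2 + (Suc m + card {z \<in> W. x < z}) * (x + 1)"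
        using Suc.prems x by blast
      show "card S' \<le> 2 * L + 1 + m\<^sup>2 + (m + ?q) * (x + 1)"
      proof (cases "x < y")
        case True
        have "{z \<in> W. x < z} = insert y {z \<in> W - {y}. x < z}" using True y by auto
        then have "card {z \<in> W. x < z} = Suc ?q" using Suc.prems by simp
        moreover have "x + 1 \<le> t" using below[of x] True x by auto
        ultimately show ?thesis using old card(2) by (simp add: power2_eq_square algebra_simps)
      next
        case False
        then have "{z \<in> W. x < z} = {z \<in> W - {y}. x < z}" by auto
        moreover have "x \<le> M" using M x by auto
        ultimately show ?thesis using old card(1) by (simp add: power2_eq_square algebra_simps)
      qed
    qed (use Suc.prems(1,4-7) S' y finite_subset[OF S'(1)] in auto)
    then obtain f where f: "range f \<subseteq> S'" "S' \<subseteq> (\<Union>k \<in> (W - {y}) \<union> {..<m}. near E k (f k))" by blast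
    let ?g = "f(y := c, m := d)"
    have "m \<notin> W" using Suc.prems by (metis Suc_n_not_le_n le_trans)
    then have "y \<noteq> m" using y by auto
    have "f k = ?g k" if "k \<in> (W - {y}) \<union> {..<m}" for k
      using that \<open>m \<notin> W\<close> y(1) Suc.prems(6)[of y] Suc.prems(7) by auto
    then have "S' \<subseteq> (\<Union>k \<in> (W - {y}) \<union> {..<m}. near E k (?g k))" using f(2) by simp
    also have "\<dots> \<subseteq> (\<Union>k \<in> W \<union> {..<Suc m}. near E k (?g k))" by (rule UN_mono) auto
    finally have "S' \<subseteq> (\<Union>k \<in> W \<union> {..<Suc m}. near E k (?g k))" .
    moreover have "near E t c \<subseteq> near E y (?g y)" using near_mono[OF y(2)] \<open>y \<noteq> m\<close> by simp
    then have "near E t c \<subseteq> (\<Union>k \<in> W \<union> {..<Suc m}. near E k (?g k))" using y by blast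
    moreover have "near E m d \<subseteq> (\<Union>k \<in> W \<union> {..<Suc m}. near E k (?g k))" by auto
    ultimately have "S \<subseteq> (\<Union>k \<in> W \<union> {..<Suc m}. near E k (?g k))" using cov by blast
    moreover have "range ?g \<subseteq> S" using f cd S' by auto
    ultimately show ?case by blast
  qed
qed

subsection \<open>Connected dominating sets\<close>

lemma conn_insert:
  assumes "sym E" "conn E I" "x \<in> I" "(x, v) \<in> E"
  shows "conn E (insert v I)"
  using conn_Un[OF assms(1,2), of "{v}" x v] assms by (simp add: conn_def)

lemma connected_dominating_set:
  assumes E: "sym E" "irrefl E" "E \<subseteq> V \<times> V" and V: "finite V" "V \<noteq> {}" "conn E V"
    and deg: "\<And>v. v \<in> V \<Longrightarrow> 3 \<le> card (E `` {v})"
  shows "\<exists>I\<subseteq>V. I \<noteq> {} \<and> conn E I \<and> V = I \<union> E `` I \<and> 4 * card I \<le> 3 * card V"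
proof -
  \<comment> \<open>\<open>B I\<close> are the leaves of a tree with inner vertices \<open>I\<close>, and \<open>D I\<close> are the dead leaves, at which the
    tree cannot be extended. A largest \<open>I\<close> with \<open>\<bar>I\<bar> \<le> 2 \<bar>B I\<bar> + \<bar>D I\<bar>\<close> dominates: otherwise one can
    add a leaf with two new neighbours, or a leaf whose only new neighbour \<open>y\<close> sees another leaf
    (which dies), or a leaf together with its only new neighbour \<open>y\<close>, which has two new neighbours.\<close>
  define B where "B I = E `` I - I" for I
  define D where "D I = {v \<in> B I. E `` {v} \<subseteq> I \<union> B I}" for I
  define good where "good I \<longleftrightarrow> I \<subseteq> V \<and> I \<noteq> {} \<and> conn E I \<and> card I \<le> 2 * card (B I) + card (D I)" for I
  have fin: "finite A" if "A \<subseteq> V" for A using V that finite_subset by blast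
  have EV: "E `` A \<subseteq> V" for A using E by blast
  have BV: "B I \<subseteq> V" for I using EV by (auto simp: B_def)
  have DV: "D I \<subseteq> V" for I using BV by (auto simp: D_def)
  obtain v where "v \<in> V" using V by blast
  moreover have "B {v} = E `` {v}" using E by (auto simp: B_def irrefl_def)
  ultimately have "good {v}" using deg[of v] by (auto simp: good_def conn_def)
  moreover have "\<forall>I. good I \<longrightarrow> card I < card V + 1"
    using V card_mono by (auto simp: good_def less_Suc_eq_le)
  ultimately obtain I where I: "good I" and max: "\<And>J. good J \<Longrightarrow> card J \<le> card I"
    using ex_has_greatest_nat[of good "{v}" card "card V + 1"] by blast
  note I' = I[unfolded good_def]
  have no_ext: "\<not> card J \<le> 2 * card (B J) + card (D J)" if "J \<subseteq> V" "conn E J" "I \<subset> J" for J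
    using max[of J] that psubset_card_mono[OF fin[OF that(1)] that(3)] by (auto simp: good_def)
  let ?Z = "I \<union> B I"
  have ZV: "?Z \<subseteq> V" using I' BV by blast
  have "V \<subseteq> ?Z"
  proof (rule ccontr)
    assume "\<not> V \<subseteq> ?Z"
    then obtain x y where xy: "x \<in> ?Z" "y \<in> V - ?Z" "(x, y) \<in> E"
      using conn_edge[OF V(3) ZV] I' by blast
    then have xB: "x \<in> B I" by (auto simp: B_def)
    then obtain i where i: "i \<in> I" "(i, x) \<in> E" by (auto simp: B_def)
    let ?out = "\<lambda>v. E `` {v} - ?Z"
    have outV: "?out v \<subseteq> V" for v using EV by blast
    \<comment> \<open>Dead leaves stay dead while no old vertex is lost and none of them becomes
      inner.\<close>
    have D_grow: "D I \<subseteq> D J" if J: "?Z \<subseteq> J \<union> B J" "J \<inter> D I = {}" "I \<subseteq> J" for J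
    proof
      fix w assume w: "w \<in> D I"
      then have "w \<in> B J" using J by (auto simp: D_def B_def)
      moreover have "E `` {w} \<subseteq> ?Z" using w by (simp add: D_def)
      ultimately show "w \<in> D J" using J(1) unfolding D_def by blast
    qed
    \<comment> \<open>Otherwise \<open>v\<close> could become inner: one leaf is lost and at least
      two are gained.\<close>
    have one: "card (?out v) \<le> 1" if v: "v \<in> B I" for v
    proof (rule ccontr)
      assume c: "\<not> card (?out v) \<le> 1"
      obtain i where i: "i \<in> I" "(i, v) \<in> E" using v by (auto simp: B_def)
      let ?J = "insert v I"
      have B: "B ?J = (B I - {v}) \<union> ?out v"
        using E v by (auto simp: B_def irrefl_def)
      have "card (B I) - 1 + card (?out v) = card (B ?J)"
        unfolding B using v fin[OF BV] fin[OF outV] by (subst card_Un_disjoint) auto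
      then have "card (B I) + 1 \<le> card (B ?J)" using c card_gt_0_iff[of "B I"] v fin[OF BV] by auto
      moreover have "?out v \<noteq> {}" using c by (metis card.empty zero_le)
      then have "v \<notin> D I" by (auto simp: D_def)
      then have "D I \<subseteq> D ?J" using v by (intro D_grow) (auto simp: B D_def B_def)
      then have "card (D I) \<le> card (D ?J)" using fin[OF DV] card_mono by blast
      moreover have "card ?J = card I + 1" using v fin I' by (auto simp: B_def)
      moreover have "conn E ?J" using conn_insert[OF E(1) _ i] I' by blast
      ultimately show False using no_ext[of ?J] I' v BV by (auto simp: B_def)
    qed
    have single: "?out v = {y}" if "v \<in> B I" "(v, y) \<in> E" for v
    proof -
      have "y \<in> ?out v" using that xy by auto
      then show ?thesis using one[OF that(1)] card_le_Suc0_iff_eq[OF fin[OF outV]] by auto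
    qed
    let ?J = "insert x I"
    have out: "?out x = {y}" using single xB xy by blast
    have Jc: "conn E ?J" using conn_insert[OF E(1) _ i] I' by blast
    have BJ: "B ?J = (B I - {x}) \<union> {y}"
      using E xB out xy by (auto simp: B_def irrefl_def)
    have cBJ: "card (B ?J) = card (B I)"
      unfolding BJ using xB xy fin[OF BV] card_gt_0_iff[of "B I"] by (subst card_Un_disjoint) auto
    have xD: "x \<notin> D I" using xy by (auto simp: D_def)
    have cJ: "card ?J = card I + 1" using xB fin I' by (auto simp: B_def)
    show False
    proof (cases "\<exists>x'\<in>B I. x' \<noteq> x \<and> (x', y) \<in> E")
      case True
      then obtain x' where x': "x' \<in> B I" "x' \<noteq> x" "(x', y) \<in> E" by blast
      have "D I \<subseteq> D ?J" using xB xD by (intro D_grow) (auto simp: BJ D_def B_def)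
      \<comment> \<open>The number of leaves is unchanged; the new inner vertex is paid for by
        \<open>x'\<close>, whose only outside neighbour \<open>y\<close> is now a leaf.\<close>
      moreover have "x' \<in> D ?J" "x' \<notin> D I"
        using x' xy single[OF x'(1,3)] by (auto simp: D_def BJ)
      ultimately have "card (D I) < card (D ?J)" using fin[OF DV] psubset_card_mono by blast
      then show False using no_ext[of ?J] Jc cBJ cJ I' xB BV by (auto simp: B_def)
    next
      case False
      let ?K = "insert y ?J"
      have yI: "(y, w) \<notin> E" if "w \<in> I" for w
        using that xy E symD[OF E(1)] by (auto simp: B_def)
      have yB: "(y, w) \<notin> E" if "w \<in> B I" "w \<noteq> x" for w
        using that False symD[OF E(1)] by blast
      \<comment> \<open>Among old vertices only \<open>x\<close> is adjacent to \<open>y\<close>, so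
        degree \<open>3\<close> yields two new leaves. The net gain of one leaf pays for two inner
        vertices.\<close>
      have y_out: "E `` {y} \<subseteq> insert x (?out y)" using yI yB by auto
      have "card (E `` {y}) \<le> card (insert x (?out y))"
        using card_mono[OF _ y_out] fin[OF outV[of y]] by simp
      also have "\<dots> \<le> card (?out y) + 1" using card_insert_le_m1 fin[OF outV] by (simp add: card_insert_if)
      finally have c2: "2 \<le> card (?out y)" using deg[of y] xy by simp
      have yy: "y \<notin> ?out y" using E by (auto simp: irrefl_def)
      have BK: "B ?K = (B I - {x}) \<union> ?out y"
        using BJ xy xB yy by (auto simp: B_def)
      have "card (B I) - 1 + card (?out y) = card (B ?K)"
        unfolding BK using xB fin[OF BV] fin[OF outV] by (subst card_Un_disjoint) auto
      then have "card (B I) + 1 \<le> card (B ?K)" using c2 card_gt_0_iff[of "B I"] xB fin[OF BV] by auto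
      moreover have "D I \<subseteq> D ?K" using xB xD xy by (intro D_grow) (auto simp: BK D_def B_def)
      then have "card (D I) \<le> card (D ?K)" using fin[OF DV] card_mono by blast
      moreover have "y \<notin> ?J" "finite ?J" using xB xy fin I' by auto
      then have "card ?K = card I + 2" using cJ by simp
      moreover have "conn E ?K" using conn_insert[OF E(1) Jc, of x y] xy by blast
      ultimately show False using no_ext[of ?K] I' xB xy BV by (auto simp: B_def)
    qed
  qed
  then have VZ: "V = ?Z" using ZV by blast
  \<comment> \<open>Nothing lies outside the tree, so every leaf is dead and the invariant reads
    \<open>card I \<le> 3 * card (B I)\<close>.\<close>
  then have "D I = B I" using EV by (auto simp: D_def)
  moreover have "card V = card I + card (B I)"
    using VZ fin I' BV card_Un_disjoint[of I "B I"] by (auto simp: B_def)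
  ultimately have "4 * card I \<le> 3 * card V" using I' by simp
  moreover have "V = I \<union> E `` I" using VZ by (auto simp: B_def)
  ultimately show ?thesis using I' by blast
qed

lemma conn_covering_radii:
  assumes E: "sym E" and S: "finite S" "conn E S" "S \<noteq> {}" and card: "4 * card S \<le> 3 * K\<^sup>2"
  shows "\<exists>f. range f \<subseteq> S \<and> S \<subseteq> (\<Union>k\<le>K. near E k (f k))"
proof -
  \<comment> \<open>The small radii are those below \<open>m\<close>, the large ones start at
    \<open>K - m\<close>; for odd \<open>K\<close>, radius \<open>m\<close> is in neither
    set.\<close>
  define m where "m = K div 2"
  have "\<exists>f. range f \<subseteq> S \<and> S \<subseteq> (\<Union>k \<in> {K - m..K} \<union> {..<m}. near E k (f k))"
  proof (rule conn_covering[where L = "K - m", OF E S])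
    fix x assume x: "x \<in> {K - m..K}"
    define j where "j = K - x"
    have j: "j \<le> m" "x + 1 = K - j + 1" "j \<le> K" using x by (auto simp: j_def m_def)
    have "{z \<in> {K - m..K}. x < z} = {x<..K}" using x by auto
    then have q: "card {z \<in> {K - m..K}. x < z} = j" by (simp add: j_def)
    have jj: "j * j \<le> j * m" using j by simp
    have "card S \<le> 2 * (K - m) + 1 + m\<^sup>2 + (m + j) * (K - j + 1)"
    proof (cases "even K")
      case True
      then have K: "K = 2 * m" by (simp add: m_def)
      have "card S \<le> 3 * (m * m)" using card by (simp add: K power2_eq_square)
      \<comment> \<open>Replacing \<open>m\<close> by \<open>j + d\<close> encodes
        \<open>j \<le> m\<close> and removes the truncated subtraction, so that the expanded sides
        compare termwise.\<close>
      moreover obtain d where d: "m = j + d" using j le_Suc_ex by blast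
      ultimately show ?thesis by (simp add: K power2_eq_square algebra_simps)
    next
      case False
      then have K: "K = 2 * m + 1" by (simp add: m_def)
      \<comment> \<open>The constant \<open>3\<close> of \<open>3 * K\<^sup>2\<close> vanishes on
        division by \<open>4\<close>.\<close>
      have "card S \<le> 3 * (m * m) + 3 * m" using card by (simp add: K power2_eq_square algebra_simps)
      moreover obtain d where d: "m = j + d" using j le_Suc_ex by blast
      ultimately show ?thesis by (simp add: K power2_eq_square algebra_simps)
    qed
    then show "card S \<le> 2 * (K - m) + 1 + m\<^sup>2 + (m + card {z \<in> {K - m..K}. x < z}) * (x + 1)"
      using q j by simp
  qed (auto simp: m_def)
  then obtain f where f: "range f \<subseteq> S" "S \<subseteq> (\<Union>k \<in> {K - m..K} \<union> {..<m}. near E k (f k))" by blast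
  have "{K - m..K} \<union> {..<m} \<subseteq> {..K}" by (auto simp: m_def)
  then have "S \<subseteq> (\<Union>k\<le>K. near E k (f k))" using f(2) by blast
  then show ?thesis using f by blast
qed

subsection \<open>The burning number\<close>

lemma (in wf_digraph) near_subset_closed_nbhd:
  assumes "u \<in> verts G" shows "near (arcs_ends G) k u \<subseteq> closed_nbhd k u"
proof -
  have mono: "closed_nbhd i u \<subseteq> closed_nbhd j u" if "i \<le> j" for i j
    using that by (auto simp: closed_nbhd_def intro: le_trans)
  have "w \<in> closed_nbhd n u" if "(u, w) \<in> arcs_ends G ^^ n" for n w
    using that assms by (induction n arbitrary: w) (auto simp: closed_nbhd_0 closed_nbhd_Suc)
  then show ?thesis using mono by (fastforce simp: near_def)
qed

theorem theorem1p2: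
  fixes G :: "('a, 'b) pre_digraph"
  assumes "graph G"
    and "Digraph_Component.connected G"
    and "\<forall>v \<in> verts G. out_degree G v \<ge> 3"
  shows "int (burning_number G) \<le> \<lceil>sqrt (real (card (verts G)))\<rceil> + 2"
proof -
  interpret graph G by fact
  let ?E = "arcs_ends G" and ?V = "verts G"
  have E: "sym ?E" using sym_arcs by (simp add: symmetric_def)
  have EV: "?E \<subseteq> ?V \<times> ?V" by (auto simp: arcs_ends_conv)
  have irr: "irrefl ?E" using adj_not_same by (auto simp: irrefl_def)
  have "strongly_connected G"
    using assms(2) symmetric_connected_imp_strongly_connected sym_arcs by blast
  then have V0: "?V \<noteq> {}" and reach: "\<And>x y. x \<in> ?V \<Longrightarrow> y \<in> ?V \<Longrightarrow> (x, y) \<in> ?E\<^sup>*"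
    by (auto simp: strongly_connected_def reachable_conv)
  have "Restr ?E ?V = ?E" using EV by blast
  then have conn: "conn ?E ?V" using reach by (simp add: conn_def)
  have deg: "3 \<le> card (?E `` {v})" if "v \<in> ?V" for v
  proof -
    have "?E `` {v} = head G ` out_arcs G v" by (auto simp: arcs_ends_conv)
    moreover have "inj_on (head G) (out_arcs G v)"
      by (rule inj_onI) (auto intro: no_multi_arcs simp: arc_to_ends_def)
    ultimately have "card (?E `` {v}) = out_degree G v" by (simp add: card_image out_degree_def)
    then show ?thesis using assms(3) that by simp
  qed
  obtain I where I: "I \<subseteq> ?V" "I \<noteq> {}" "conn ?E I" "?V = I \<union> ?E `` I" "4 * card I \<le> 3 * card ?V"
    using connected_dominating_set[OF E irr EV finite_verts V0 conn deg] by blast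
  define K where "K = nat \<lceil>sqrt (real (card ?V))\<rceil>"
  \<comment> \<open>Makes the ceiling nonnegative, so that \<open>nat\<close> loses nothing.\<close>
  have "-1 < sqrt (real (card ?V))" using real_sqrt_ge_zero[of "real (card ?V)"] by linarith
  then have K: "int K = \<lceil>sqrt (real (card ?V))\<rceil>" by (simp add: K_def)
  have "sqrt (real (card ?V)) \<le> real K" unfolding K_def by (rule real_nat_ceiling_ge)
  then have "(sqrt (real (card ?V)))\<^sup>2 \<le> (real K)\<^sup>2" by (intro power_mono) auto
  then have "real (card ?V) \<le> real (K\<^sup>2)" by simp
  then have "card ?V \<le> K\<^sup>2" by (simp only: of_nat_le_iff)
  then have "4 * card I \<le> 3 * K\<^sup>2" using I by simp
  then obtain f where f: "range f \<subseteq> I" "I \<subseteq> (\<Union>k\<le>K. near ?E k (f k))"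
    using conn_covering_radii[OF E finite_subset[OF I(1) finite_verts] I(3,2)] by metis
  have fV: "f k \<in> ?V" for k using f I by blast
  \<comment> \<open>The centre for radius \<open>k\<close> is lit at step \<open>K + 1 - k\<close>
    and has radius \<open>k + 1\<close> after \<open>K + 2\<close> steps, which reaches the
    neighbours of the covered part of \<open>I\<close>. At step \<open>K + 2\<close> truncated
    subtraction gives \<open>f 0\<close>, again a vertex.\<close>
  let ?v = "\<lambda>i. f (K + 1 - i)"
  have "x \<in> (\<Union>i \<in> {1..K + 2}. closed_nbhd (K + 2 - i) (?v i))" if x: "x \<in> ?V" for x
  proof -
    obtain z where z: "z \<in> I" "x = z \<or> (z, x) \<in> ?E" using x I by blast
    then obtain k where k: "k \<le> K" "z \<in> near ?E k (f k)" using f by blast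
    then have "z \<in> closed_nbhd k (f k)" using near_subset_closed_nbhd fV by blast
    then have "x \<in> closed_nbhd (Suc k) (f k)" using z by (auto simp: closed_nbhd_Suc)
    then show ?thesis using k by (intro UN_I[of "K + 1 - k"]) auto
  qed
  moreover have "closed_nbhd k u \<subseteq> ?V" for k u by (auto simp: closed_nbhd_def)
  ultimately have "(\<Union>i \<in> {1..K + 2}. closed_nbhd (K + 2 - i) (?v i)) = ?V" by blast
  then have "k_burnable G (K + 2)" unfolding k_burnable_iff using fV by (intro exI[of _ ?v]) auto
  then have "burning_number G \<le> K + 2" unfolding burning_number_def by (rule Least_le)
  then show ?thesis using K by simp
qed

end
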